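(* Let $k\ge 2$ be an integer and let $G$ be a finite, simple, connected, $k$-colourable graph such that $S_k(G)$ is connected. Let $G^*$ be the graph obtained from $G$ by adding a new vertex $v^*$ and joining it to exactly $j$ vertices of $V(G)$, where $1\le j\le k-2$. Then $S_k(G^* )$ is connected.
   Context: A proper $k$-colouring of a graph $G$ is a map $V(G)\to\{1,\dots,k\}$ giving adjacent vertices different colours. It is called a strong $k$-colouring if all $k$ colours actually appear. The strong $k$-colour graph $S_k(G)$ is the graph whose vertex set is the set of strong $k$-colourings of $G$, two colourings being adjacent if and only if they differ in colour on exactly one vertex of $G$. *)

theory Defs
  imports "Graph_Theory.Graph_Theory" "HOL-Library.FuncSet"
begin

text \<open>
  Finite simple graphs are the structures satisfying the predicate \<open>pair_graph\<close> of
  \<open>Graph_Theory\<close>: an edge is represented by its two opposite arcs. The library's notion of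
  connectedness requires at least one vertex, so a colour graph without vertices does not
  count as connected.
\<close>

text \<open>
  Colourings are extensional functions (\<open>undefined\<close> outside the vertex set), so that two
  colourings are equal as HOL functions exactly when they agree on all vertices.
\<close>

definition proper_colourings :: "nat \<Rightarrow> 'a pair_pre_digraph \<Rightarrow> ('a \<Rightarrow> nat) set" where
  "proper_colourings k G =
     {c \<in> pverts G \<rightarrow>\<^sub>E {1..k}. \<forall>(u, v) \<in> parcs G. c u \<noteq> c v}"

definition colourable :: "nat \<Rightarrow> 'a pair_pre_digraph \<Rightarrow> bool" where
  "colourable k G \<longleftrightarrow> proper_colourings k G \<noteq> {}"

definition strong_colourings :: "nat \<Rightarrow> 'a pair_pre_digraph \<Rightarrow> ('a \<Rightarrow> nat) set" where
  "strong_colourings k G = {c \<in> proper_colourings k G. c ` pverts G = {1..k}}"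

definition strong_colour_graph ::
    "nat \<Rightarrow> 'a pair_pre_digraph \<Rightarrow> ('a \<Rightarrow> nat) pair_pre_digraph" where
  "strong_colour_graph k G =
     \<lparr> pverts = strong_colourings k G,
       parcs = {(c, d). c \<in> strong_colourings k G \<and> d \<in> strong_colourings k G \<and>
                        (\<exists>!v. v \<in> pverts G \<and> c v \<noteq> d v)} \<rparr>"

definition attach_vertex ::
    "'a pair_pre_digraph \<Rightarrow> 'a \<Rightarrow> 'a set \<Rightarrow> 'a pair_pre_digraph" where
  "attach_vertex G v N =
     \<lparr> pverts = insert v (pverts G), parcs = parcs G \<union> {v} \<times> N \<union> N \<times> {v} \<rparr>"

lemma pair_graph_attach_vertex:
  assumes "pair_graph G" and "v \<notin> pverts G" and "N \<subseteq> pverts G"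
  shows "pair_graph (attach_vertex G v N)"
proof -
  interpret pair_graph G by fact
  have "finite N"
    using assms(3) pair_finite_verts finite_subset by blast
  moreover have "sym (parcs G)"
    using pair_sym_arcs by (simp add: symmetric_def)
  ultimately show ?thesis
    using assms(2,3) pair_finite_verts pair_finite_arcs pair_no_loops wellformed'
    by unfold_locales (auto simp: attach_vertex_def symmetric_def sym_def)
qed

lemma pair_graph_strong_colour_graph:
  assumes "pair_graph G"
  shows "pair_graph (strong_colour_graph k G)"
proof -
  interpret pair_graph G by fact
  have "finite (strong_colourings k G)"
    by (rule finite_subset[of _ "pverts G \<rightarrow>\<^sub>E {1..k}"])
      (auto simp: strong_colourings_def proper_colourings_def
        intro!: finite_PiE pair_finite_verts)
  moreover from this have "finite (strong_colourings k G \<times> strong_colourings k G)"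
    by simp
  then have "finite (parcs (strong_colour_graph k G))"
    by (rule rev_finite_subset) (auto simp: strong_colour_graph_def)
  moreover have "sym (parcs (strong_colour_graph k G))"
    by (auto simp: strong_colour_graph_def sym_def)
  ultimately show ?thesis
    by unfold_locales (auto simp: strong_colour_graph_def symmetric_def)
qed

end

theory Submission
  imports Defs "HOL-Combinatorics.Transposition"
begin

text \<open>
  Two colourings of \<open>G\<^sup>*\<close> that are strong on \<open>G\<close> are joined by following a path of \<open>S\<^sub>k(G)\<close>:
  since at most \<open>k - 2\<close> colours occur on the neighbours of \<open>v\<^sup>*\<close>, before each step the new vertex
  can be moved out of the way of the colour about to be introduced.

  In any other strong colouring of \<open>G\<^sup>*\<close> the colour of \<open>v\<^sup>*\<close> is not used on \<open>G\<close>, and some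
  colour is repeated on \<open>G\<close>. If \<open>G\<close> were the join of two nonempty parts, then the set of colours
  on each part would be constant along paths of \<open>S\<^sub>k(G)\<close>, which would be disconnected; hence
  the complement of \<open>G\<close> is connected. Giving a vertex with repeated colour the colour of a
  non-neighbour makes the latter colour repeated, so the repetition can be carried along the
  complement to a vertex not adjacent to \<open>v\<^sup>*\<close>, which can then take the colour of \<open>v\<^sup>*\<close>.
\<close>

section \<open>Reachability in colour graphs and recolouring of single vertices\<close>

text \<open>Since the arcs of \<open>H\<close> are symmetric, symmetrising adds nothing, and
  connectedness can be handled with the reflexive transitive closure of the arc relation.\<close>

lemma connected_pair_graph_iff:
  assumes "pair_graph H"
  shows "Digraph_Component.connected (with_proj H) \<longleftrightarrow>
    pverts H \<noteq> {} \<and> (\<forall>u\<in>pverts H. \<forall>w\<in>pverts H. (u, w) \<in> (parcs H)\<^sup>*)"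
proof -
  interpret pair_graph H by fact
  have "parcs (mk_symmetric (with_proj H)) = parcs H"
    using adj_mk_symmetric_eq[OF sym_arcs] by simp
  moreover have "u \<rightarrow>\<^sup>*\<^bsub>with_proj H\<^esub> w \<longleftrightarrow> (u, w) \<in> (parcs H)\<^sup>*"
    if "u \<in> pverts H" "w \<in> pverts H" for u w
    using reachable_rtranclI[of "with_proj H" u w]
      rtrancl_consistent_rtrancl_on[of u w "parcs H" "pverts H"] that in_arcsD2
    by (auto simp: reachable_def)
  ultimately show ?thesis
    by (simp add: connected_def strongly_connected_def reachable_def)
qed

lemma strong_colourings_iff:
  "c \<in> strong_colourings k G \<longleftrightarrow> c \<in> extensional (pverts G) \<and> c ` pverts G = {1..k} \<and>
     (\<forall>(u, w)\<in>parcs G. c u \<noteq> c w)"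
  by (auto simp: strong_colourings_def proper_colourings_def PiE_iff)

lemma strong_colour_graph_arc_iff:
  "(c, d) \<in> parcs (strong_colour_graph k G) \<longleftrightarrow>
     c \<in> strong_colourings k G \<and> d \<in> strong_colourings k G \<and>
     (\<exists>x a. x \<in> pverts G \<and> a \<noteq> c x \<and> d = c(x := a))" (is "?L \<longleftrightarrow> ?R")
proof
  assume L: ?L
  then have "\<exists>!x. x \<in> pverts G \<and> c x \<noteq> d x"
    by (simp add: strong_colour_graph_def)
  then obtain x where x: "x \<in> pverts G" "c x \<noteq> d x"
      and uniq: "\<And>y. y \<in> pverts G \<Longrightarrow> c y \<noteq> d y \<Longrightarrow> y = x"
    by blast
  from L have "c \<in> extensional (pverts G)" "d \<in> extensional (pverts G)"
    by (auto simp: strong_colour_graph_def strong_colourings_iff)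
  then have "c y = d y" if "y \<noteq> x" for y
    using uniq[of y] that by (metis extensional_arb)
  then have "d = c(x := d x)" by fastforce
  moreover have "c \<in> strong_colourings k G" "d \<in> strong_colourings k G"
    using L by (auto simp: strong_colour_graph_def)
  ultimately show ?R
    using x by metis
next
  assume ?R
  then obtain x a where "c \<in> strong_colourings k G" "d \<in> strong_colourings k G"
    and x: "x \<in> pverts G" "a \<noteq> c x" "d = c(x := a)"
    by blast
  moreover have "\<exists>!y. y \<in> pverts G \<and> c y \<noteq> d y"
    using x by (intro ex1I[of _ x]) (auto split: if_splits)
  ultimately show ?L
    by (simp add: strong_colour_graph_def)
qed

text \<open>The closure absorbs the case \<open>a = c x\<close>, so a move need not be checked for
  actually changing a colour.\<close>

lemma strong_colour_graph_recolour:
  assumes "c \<in> strong_colourings k G" and "c(x := a) \<in> strong_colourings k G" and "x \<in> pverts G"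
  shows "(c, c(x := a)) \<in> (parcs (strong_colour_graph k G))\<^sup>*"
proof (cases "a = c x")
  case False
  then have "(c, c(x := a)) \<in> parcs (strong_colour_graph k G)"
    using assms by (auto simp: strong_colour_graph_arc_iff)
  then show ?thesis ..
qed auto

text \<open>By \<open>rep\<close> the old colour of \<open>x\<close> survives at another vertex, so
  no colour is lost; \<open>free\<close> keeps the colouring proper.\<close>

lemma strong_colouring_update:
  assumes "pair_graph G" and c: "c \<in> strong_colourings k G" and x: "x \<in> pverts G"
    and a: "a \<in> {1..k}" and free: "\<And>u. (x, u) \<in> parcs G \<Longrightarrow> c u \<noteq> a"
    and rep: "c x \<in> c ` (pverts G - {x})"
  shows "c(x := a) \<in> strong_colourings k G"
proof -
  interpret pair_graph G by fact
  have im: "c ` pverts G = {1..k}" and ext: "c \<in> extensional (pverts G)"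
    and proper: "\<And>u w. (u, w) \<in> parcs G \<Longrightarrow> c u \<noteq> c w"
    using c by (auto simp: strong_colourings_iff)
  have "c ` pverts G = c ` (pverts G - {x})"
    using rep x by blast
  then have "(c(x := a)) ` pverts G = insert a (c ` pverts G)"
    using x by auto
  also have "\<dots> = {1..k}"
    using a im by auto
  finally have "(c(x := a)) ` pverts G = {1..k}" .
  moreover have "(c(x := a)) u \<noteq> (c(x := a)) w" if "(u, w) \<in> parcs G" for u w
    using that proper[OF that] free[of u] free[of w] arcs_symmetric[OF that] no_loops'[OF that]
    by auto
  moreover have "c(x := a) \<in> extensional (pverts G)"
    using ext x by (auto simp: extensional_def)
  ultimately show ?thesis
    unfolding strong_colourings_iff by blast
qed

section \<open>Joins and connectedness of the complement\<close>

text \<open>A recoloured vertex of \<open>C\<close> takes a colour that was already in use, because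
  the previous colouring is onto. A user outside \<open>C\<close> keeps that colour and is adjacent
  to the recoloured vertex, so some user must lie in \<open>C\<close>.\<close>

lemma join_palette_antimono:
  assumes "(c, d) \<in> (parcs (strong_colour_graph k G))\<^sup>*" and "C \<subseteq> pverts G"
    and join: "\<And>x y. x \<in> C \<Longrightarrow> y \<in> pverts G - C \<Longrightarrow> (x, y) \<in> parcs G"
  shows "d ` C \<subseteq> c ` C"
  using assms(1)
proof (induction rule: rtrancl_induct)
  case (step d e)
  from step.hyps(2) obtain x a where d: "d \<in> strong_colourings k G"
    and e: "e \<in> strong_colourings k G" "e = d(x := a)"
    by (auto simp: strong_colour_graph_arc_iff)
  have "e z \<in> d ` C" if z: "z \<in> C" for z
  proof -
    have "e z \<in> d ` pverts G"
      using d e z assms(2) unfolding strong_colourings_iff by blast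
    then obtain u where u: "u \<in> pverts G" "e z = d u" by blast
    show ?thesis
    proof (cases "u \<in> C")
      case False
      then have "e z \<noteq> e u"
        using join[OF z, of u] u e(1) by (auto simp: strong_colourings_iff)
      then have "z \<noteq> x"
        using u e(2) by (auto split: if_splits)
      then show ?thesis
        using z e(2) by simp
    qed (use u in auto)
  qed
  with step.IH show ?case by blast
qed simp

lemma connected_strong_colour_graph_not_join:
  assumes "pair_graph G" and "Digraph_Component.connected (with_proj (strong_colour_graph k G))"
    and C: "C \<subseteq> pverts G" "C \<noteq> {}" "C \<noteq> pverts G"
  obtains x y where "x \<in> C" "y \<in> pverts G - C" "(x, y) \<notin> parcs G"
proof (rule ccontr)
  assume "\<not> thesis"
  then have join: "\<And>x y. x \<in> C \<Longrightarrow> y \<in> pverts G - C \<Longrightarrow> (x, y) \<in> parcs G"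
    using that by blast
  interpret pair_graph G by fact
  have conn: "strong_colourings k G \<noteq> {}"
    "\<And>c d. c \<in> strong_colourings k G \<Longrightarrow> d \<in> strong_colourings k G \<Longrightarrow>
      (c, d) \<in> (parcs (strong_colour_graph k G))\<^sup>*"
    using assms(2) connected_pair_graph_iff[OF pair_graph_strong_colour_graph[OF assms(1), of k]]
    by (auto simp: strong_colour_graph_def)
  from conn(1) obtain c where c: "c \<in> strong_colourings k G" by blast
  obtain p q where p: "p \<in> C" and q: "q \<in> pverts G - C"
    using C by blast
  \<comment> \<open>Swapping one colour from each side puts \<open>c q\<close> into the palette of
    \<open>C\<close>, where \<open>c\<close> cannot have it because \<open>q\<close> is adjacent to
    all of \<open>C\<close>.\<close>
  define s where "s = Transposition.transpose (c p) (c q)"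
  define d where "d = restrict (s \<circ> c) (pverts G)"
  have im: "c ` pverts G = {1..k}"
    using c by (simp add: strong_colourings_iff)
  have "c p \<in> {1..k}" "c q \<in> {1..k}"
    using im p q C(1) by blast+
  then have "s ` {1..k} = {1..k}"
    by (simp add: s_def)
  moreover have "d ` pverts G = s ` c ` pverts G"
    by (simp add: d_def image_image)
  ultimately have "d ` pverts G = {1..k}"
    using im by simp
  moreover have "d u \<noteq> d w" if "(u, w) \<in> parcs G" for u w
  proof -
    have "c u \<noteq> c w" using c that by (auto simp: strong_colourings_iff)
    then show ?thesis
      using that wellformed'
      by (auto simp: d_def s_def transpose_eq_iff)
  qed
  moreover have "d \<in> extensional (pverts G)"
    by (simp add: d_def)
  ultimately have "d \<in> strong_colourings k G"
    unfolding strong_colourings_iff by blast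
  then have "d ` C \<subseteq> c ` C"
    using join_palette_antimono[OF conn(2)[OF c] C(1) join] by blast
  moreover have "d p = c q"
    using p C(1) by (auto simp: d_def s_def)
  ultimately obtain z where "z \<in> C" "c z = c q"
    using p by (metis imageE image_eqI subsetD)
  with join[OF \<open>z \<in> C\<close> q] c show False
    unfolding strong_colourings_iff by blast
qed

section \<open>Colourings of the extended graph that are strong on \<open>G\<close>\<close>

lemma pverts_attach_vertex [simp]: "pverts (attach_vertex G v N) = insert v (pverts G)"
  by (simp add: attach_vertex_def)

lemma parcs_attach_vertex [simp]:
  "parcs (attach_vertex G v N) = parcs G \<union> {v} \<times> N \<union> N \<times> {v}"
  by (simp add: attach_vertex_def)

lemma strong_colouring_extend:
  assumes "pair_graph G" and "v \<notin> pverts G" and "N \<subseteq> pverts G"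
    and c: "c \<in> strong_colourings k G" and t: "t \<in> {1..k} - c ` N"
  shows "c(v := t) \<in> strong_colourings k (attach_vertex G v N)"
proof -
  interpret pair_graph G by fact
  have "(c(v := t)) ` pverts G = {1..k}"
    using c assms(2) by (auto simp: strong_colourings_iff)
  then have "(c(v := t)) ` insert v (pverts G) = {1..k}"
    using t by auto
  moreover have "c(v := t) \<in> extensional (insert v (pverts G))"
    using c by (auto simp: strong_colourings_iff extensional_def)
  moreover have "u \<noteq> v \<and> w \<noteq> v \<and> c u \<noteq> c w" if "(u, w) \<in> parcs G" for u w
    using that c wellformed' assms(2) by (auto simp: strong_colourings_iff)
  then have "\<forall>(u, w)\<in>parcs G. (c(v := t)) u \<noteq> (c(v := t)) w"
    by fastforce
  moreover have "\<forall>(u, w)\<in>{v} \<times> N \<union> N \<times> {v}. (c(v := t)) u \<noteq> (c(v := t)) w"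
    using t assms(2,3) by (auto split: if_splits)
  ultimately show ?thesis
    unfolding strong_colourings_iff pverts_attach_vertex parcs_attach_vertex by blast
qed

lemma strong_colouring_restrict:
  assumes "pair_graph G" and "v \<notin> pverts G" and "N \<subseteq> pverts G"
    and f: "f \<in> strong_colourings k (attach_vertex G v N)" and im: "f ` pverts G = {1..k}"
  obtains c t where "c \<in> strong_colourings k G" "t \<in> {1..k} - c ` N" "f = c(v := t)"
proof
  interpret pair_graph G by fact
  have "u \<noteq> v \<and> w \<noteq> v \<and> f u \<noteq> f w" if "(u, w) \<in> parcs G" for u w
    using that f wellformed' assms(2) by (auto simp: strong_colourings_iff ball_Un)
  moreover have "(f(v := undefined)) ` pverts G = {1..k}"
    using im assms(2) by auto
  moreover have "f(v := undefined) \<in> extensional (pverts G)"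
    using f by (auto simp: strong_colourings_iff extensional_def)
  ultimately show "f(v := undefined) \<in> strong_colourings k G"
    by (fastforce simp: strong_colourings_iff)
  show "f v \<in> {1..k} - (f(v := undefined)) ` N"
    using f assms(2,3) by (auto simp: strong_colourings_iff image_iff)
qed simp

text \<open>The induction removes the first step of the path and leaves \<open>t\<close> arbitrary,
  since the colour of \<open>v\<close> changes along the way.\<close>

lemma strong_colouring_extensions_reachable:
  assumes G: "pair_graph G" and v: "v \<notin> pverts G" and N: "N \<subseteq> pverts G" and card: "card N < k - 1"
    and "(c, d) \<in> (parcs (strong_colour_graph k G))\<^sup>*" and "d \<in> strong_colourings k G"
    and "t \<in> {1..k} - c ` N" and "s \<in> {1..k} - d ` N"
  shows "(c(v := t), d(v := s)) \<in> (parcs (strong_colour_graph k (attach_vertex G v N)))\<^sup>*"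
  using assms(5,7)
proof (induction arbitrary: t rule: converse_rtrancl_induct)
  case base
  have "(d(v := t), d(v := t, v := s)) \<in> (parcs (strong_colour_graph k (attach_vertex G v N)))\<^sup>*"
    by (rule strong_colour_graph_recolour)
      (use strong_colouring_extend[OF G v N assms(6)] base assms(8) in simp_all)
  then show ?case by (simp only: fun_upd_upd)
next
  case (step c e)
  from step.hyps(1) obtain x a where c: "c \<in> strong_colourings k G"
    and e: "e \<in> strong_colourings k G" "e = c(x := a)" and x: "x \<in> pverts G"
    by (auto simp: strong_colour_graph_arc_iff)
  have "finite N"
    using G N pair_fin_digraph.pair_finite_verts finite_subset
    by (metis pair_digraph.axioms(1) pair_graph_def)
  \<comment> \<open>At most \<open>card N + 1 < k\<close> colours are excluded, so some
    \<open>t'\<close> avoids both \<open>a\<close> and the colours of \<open>c\<close> on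
    \<open>N\<close>. Such a \<open>t'\<close> is legal at \<open>v\<close> before and after
    \<open>x\<close> is recoloured.\<close>
  then have "card (insert a (c ` N)) \<le> Suc (card N)"
    by (metis card_image_le card_insert_le_m1 card_insert_if finite_imageI le_SucI not_less_eq_eq)
  also have "\<dots> < card {1..k}" using card by simp
  finally have "\<not> {1..k} \<subseteq> insert a (c ` N)"
    using \<open>finite N\<close> by (meson card_mono finite_imageI finite_insert not_le)
  then obtain t' where t': "t' \<in> {1..k}" "t' \<notin> insert a (c ` N)" by blast
  then have t'e: "t' \<in> {1..k} - e ` N"
    using e(2) by auto
  have ct': "c(v := t') \<in> strong_colourings k (attach_vertex G v N)"
    using strong_colouring_extend[OF G v N c] t' by simp
  have "(c(v := t), c(v := t')) \<in> (parcs (strong_colour_graph k (attach_vertex G v N)))\<^sup>*"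
    using strong_colour_graph_recolour[of "c(v := t)" k "attach_vertex G v N" v t']
      strong_colouring_extend[OF G v N c step.prems] ct' by simp
  also have "e(v := t') = (c(v := t'))(x := a)"
    using e(2) x v by (auto simp: fun_upd_twist)
  then have "(c(v := t'), e(v := t')) \<in> (parcs (strong_colour_graph k (attach_vertex G v N)))\<^sup>*"
    using strong_colour_graph_recolour[of "c(v := t')" k "attach_vertex G v N" x a]
      strong_colouring_extend[OF G v N e(1) t'e] ct' x by simp
  also have "(e(v := t'), d(v := s)) \<in> (parcs (strong_colour_graph k (attach_vertex G v N)))\<^sup>*"
    by (rule step.IH[OF t'e])
  finally show ?case .
qed

section \<open>Colourings in which the colour of the new vertex is missing on
  \<open>G\<close>\<close>

lemma reaches_strong_on_base:
  assumes G: "pair_graph G" and v: "v \<notin> pverts G" and N: "N \<subseteq> pverts G"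
    and conn: "Digraph_Component.connected (with_proj (strong_colour_graph k G))"
    and w: "w \<in> pverts G - N" and card: "k \<le> card (pverts G)"
    and f: "f \<in> strong_colourings k (attach_vertex G v N)"
  obtains g where "(f, g) \<in> (parcs (strong_colour_graph k (attach_vertex G v N)))\<^sup>*"
    "g \<in> strong_colourings k (attach_vertex G v N)" "g ` pverts G = {1..k}"
proof -
  interpret pair_graph G by fact
  let ?H = "attach_vertex G v N"
  let ?V = "pverts G"
  let ?R = "(parcs (strong_colour_graph k ?H))\<^sup>*"
  have H: "pair_graph ?H"
    by (rule pair_graph_attach_vertex[OF G v N])
  \<comment> \<open>A vertex is good if a repetition of its colour always suffices to reach a
    colouring strong on \<open>G\<close>. All \<open>f\<close> are quantified over because the
    colouring changes while the repetition is carried along.\<close>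
  define good where "good x \<longleftrightarrow> (\<forall>f\<in>strong_colourings k ?H. f v \<notin> f ` ?V \<longrightarrow>
      f x \<in> f ` (?V - {x}) \<longrightarrow> (\<exists>g\<in>strong_colourings k ?H. (f, g) \<in> ?R \<and> g ` ?V = {1..k}))" for x
  have good_outside: "good x" if x: "x \<in> ?V - N" for x
    unfolding good_def
  proof (intro ballI impI)
    fix f assume f: "f \<in> strong_colourings k ?H" and new: "f v \<notin> f ` ?V"
      and rep: "f x \<in> f ` (?V - {x})"
    have im: "f ` insert v ?V = {1..k}"
      using f by (simp add: strong_colourings_iff)
    \<comment> \<open>As \<open>x\<close> is not adjacent to \<open>v\<close> and \<open>f v\<close>
      does not occur on \<open>G\<close>, no neighbour of \<open>x\<close> has the colour
      \<open>f v\<close>.\<close>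
    have g: "f(x := f v) \<in> strong_colourings k ?H"
    proof (rule strong_colouring_update[OF H f])
      show "f v \<in> {1..k}" using im by blast
      show "f u \<noteq> f v" if "(x, u) \<in> parcs ?H" for u
      proof -
        have "u \<in> ?V" using that x v in_arcsD2[of x u] by auto
        with new show ?thesis by (metis image_eqI)
      qed
    qed (use x rep in auto)
    have "f ` ?V = f ` (?V - {x})"
      using rep x by blast
    then have "(f(x := f v)) ` ?V = insert (f v) (f ` ?V)"
      using x by auto
    then have "(f(x := f v)) ` ?V = {1..k}"
      using im by simp
    moreover have "(f, f(x := f v)) \<in> ?R"
      using strong_colour_graph_recolour[OF f g] x by simp
    ultimately show "\<exists>g\<in>strong_colourings k ?H. (f, g) \<in> ?R \<and> g ` ?V = {1..k}"
      using g by blast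
  qed
  have good_step: "good x"
    if x: "x \<in> ?V" and y: "y \<in> ?V" and "x \<noteq> y" and nadj: "(x, y) \<notin> parcs G" and "good y" for x y
    unfolding good_def
  proof (intro ballI impI)
    fix f assume f: "f \<in> strong_colourings k ?H" and new: "f v \<notin> f ` ?V"
      and rep: "f x \<in> f ` (?V - {x})"
    show "\<exists>g\<in>strong_colourings k ?H. (f, g) \<in> ?R \<and> g ` ?V = {1..k}"
    proof (cases "f y \<in> f ` (?V - {y})")
      case True
      with \<open>good y\<close> f new show ?thesis
        by (auto simp: good_def)
    next
      case False
      \<comment> \<open>Here the colour of \<open>y\<close> occurs on \<open>G\<close> only at
        \<open>y\<close>, a non-neighbour of \<open>x\<close>, so \<open>x\<close> may take it; the
        repetition has then moved to \<open>y\<close>.\<close>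
      let ?f = "f(x := f y)"
      have im: "f ` insert v ?V = {1..k}"
        using f by (simp add: strong_colourings_iff)
      have f': "?f \<in> strong_colourings k ?H"
      proof (rule strong_colouring_update[OF H f])
        show "f y \<in> {1..k}" using im y by blast
        show "f u \<noteq> f y" if u: "(x, u) \<in> parcs ?H" for u
        proof
          assume eq: "f u = f y"
          with new y have "u \<noteq> v" by auto
          then have "(x, u) \<in> parcs G" using u x v by auto
          then show False
            using nadj False eq in_arcsD2[of x u] by (metis Diff_iff image_eqI singletonD)
        qed
      qed (use x rep in auto)
      have "?f v \<notin> ?f ` ?V"
        using new x y v by auto
      moreover have "?f y \<in> ?f ` (?V - {y})"
        using x \<open>x \<noteq> y\<close> by (intro image_eqI[of _ _ x]) auto
      ultimately obtain g where "g \<in> strong_colourings k ?H" "(?f, g) \<in> ?R" "g ` ?V = {1..k}"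
        using \<open>good y\<close> f' unfolding good_def by blast
      moreover have "(f, ?f) \<in> ?R"
        using strong_colour_graph_recolour[OF f f'] x by simp
      ultimately show ?thesis
        by (meson rtrancl_trans)
    qed
  qed
  \<comment> \<open>Goodness spreads from \<open>w\<close> along non-adjacent pairs; if it stopped
    at a proper subset, \<open>G\<close> would be a join.\<close>
  have "{x \<in> ?V. good x} = ?V"
  proof (rule ccontr)
    assume proper: "{x \<in> ?V. good x} \<noteq> ?V"
    have nonempty: "{x \<in> ?V. good x} \<noteq> {}"
      using w good_outside by blast
    obtain y x where y: "y \<in> {x \<in> ?V. good x}" and x: "x \<in> ?V - {x \<in> ?V. good x}"
      and nadj: "(y, x) \<notin> parcs G"
      by (rule connected_strong_colour_graph_not_join[OF G conn Collect_restrict nonempty proper])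
    have "good x"
      using x y nadj arcs_symmetric[of x y] by (intro good_step[of x y]) auto
    with x show False by simp
  qed
  then have good: "\<And>x. x \<in> ?V \<Longrightarrow> good x" by blast
  show thesis
  proof (cases "f v \<in> f ` ?V")
    case True
    then have "f ` ?V = {1..k}"
      using f by (auto simp: strong_colourings_iff insert_absorb)
    with f that show thesis by blast
  next
    case False
    have "insert (f v) (f ` ?V) = {1..k}"
      using f by (simp add: strong_colourings_iff)
    \<comment> \<open>Pigeonhole: \<open>G\<close> carries only \<open>k - 1\<close> colours on at
      least \<open>k\<close> vertices.\<close>
    then have "Suc (card (f ` ?V)) = k"
      using False pair_finite_verts
      by (metis card_insert_disjoint card_atLeastAtMost diff_Suc_1 finite_imageI)
    then have "\<not> inj_on f ?V"
      using card card_image[of f ?V] by auto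
    then obtain x y where "x \<in> ?V" "y \<in> ?V" "x \<noteq> y" "f x = f y"
      by (auto simp: inj_on_def)
    then have "x \<in> ?V" "f x \<in> f ` (?V - {x})" by auto
    with good[of x] f False that show thesis
      by (auto simp: good_def)
  qed
qed

theorem theorem2p2:
  fixes k j :: nat and G :: "'a pair_pre_digraph" and v :: 'a and N :: "'a set"
  assumes "k \<ge> 2"
    and "pair_graph G"
    and "Digraph_Component.connected (with_proj G)"
    and "colourable k G"
    and "Digraph_Component.connected (with_proj (strong_colour_graph k G))"
    and "v \<notin> pverts G"
    and "N \<subseteq> pverts G"
    and "card N = j"
    and "1 \<le> j" and "j \<le> k - 2"
  shows "Digraph_Component.connected
           (with_proj (strong_colour_graph k (attach_vertex G v N)))"
proof -
  interpret pair_graph G by fact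
  let ?H = "attach_vertex G v N"
  let ?S = "strong_colour_graph k ?H"
  have H: "pair_graph ?H" and S: "pair_graph ?S"
    using assms by (simp_all add: pair_graph_attach_vertex pair_graph_strong_colour_graph)
  have pverts_S: "pverts (strong_colour_graph k K) = strong_colourings k K" for K :: "'a pair_pre_digraph"
    by (simp add: strong_colour_graph_def)
  have conn: "strong_colourings k G \<noteq> {}"
    "\<And>c d. c \<in> strong_colourings k G \<Longrightarrow> d \<in> strong_colourings k G \<Longrightarrow>
      (c, d) \<in> (parcs (strong_colour_graph k G))\<^sup>*"
    using assms(5) connected_pair_graph_iff[OF pair_graph_strong_colour_graph[OF assms(2), of k]]
    by (auto simp: pverts_S)
  from conn(1) obtain c where c: "c \<in> strong_colourings k G" by blast
  \<comment> \<open>With \<open>k \<ge> 2\<close> the subtraction is not truncated, so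
    \<open>k - 2\<close> lies strictly below \<open>k - 1\<close>.\<close>
  have card_N: "card N < k - 1" using assms(1,8,9,10) by simp
  have "finite N" using assms(7) pair_finite_verts finite_subset by blast
  then have "card (c ` N) < card {1..k}"
    using card_image_le[of N c] card_N by simp
  then obtain t where "t \<in> {1..k} - c ` N"
    using \<open>finite N\<close> by (metis DiffI card_mono finite_imageI not_le subsetI)
  then have "strong_colourings k ?H \<noteq> {}"
    using strong_colouring_extend[OF assms(2,6,7) c] by blast
  moreover
  have "c ` pverts G = {1..k}" using c by (simp add: strong_colourings_iff)
  then have card_V: "k \<le> card (pverts G)"
    using card_image_le[OF pair_finite_verts, of c] by simp
  \<comment> \<open>A vertex outside \<open>N\<close> is the starting point for goodness.\<close>
  then have "N \<noteq> pverts G" using card_N by auto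
  then obtain w where w: "w \<in> pverts G - N" using assms(7) by blast
  note reach = reaches_strong_on_base[OF assms(2,6,7,5) w card_V]
  have "(f, g) \<in> (parcs ?S)\<^sup>*"
    if f: "f \<in> strong_colourings k ?H" and g: "g \<in> strong_colourings k ?H" for f g
  proof -
    \<comment> \<open>Both ends are first moved to colourings strong on \<open>G\<close>, which are
      then joined by lifting a path between their restrictions; symmetry reverses the last
      stretch.\<close>
    obtain f' where f': "(f, f') \<in> (parcs ?S)\<^sup>*" "f' \<in> strong_colourings k ?H" "f' ` pverts G = {1..k}"
      using reach[OF f] by blast
    obtain g' where g': "(g, g') \<in> (parcs ?S)\<^sup>*" "g' \<in> strong_colourings k ?H" "g' ` pverts G = {1..k}"
      using reach[OF g] by blast
    obtain c t d s where c: "c \<in> strong_colourings k G" "t \<in> {1..k} - c ` N" "f' = c(v := t)"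
      and d: "d \<in> strong_colourings k G" "s \<in> {1..k} - d ` N" "g' = d(v := s)"
      using strong_colouring_restrict[OF assms(2,6,7) f'(2,3)]
        strong_colouring_restrict[OF assms(2,6,7) g'(2,3)] by metis
    have "(f', g') \<in> (parcs ?S)\<^sup>*"
      using strong_colouring_extensions_reachable[OF assms(2,6,7) card_N conn(2)[OF c(1) d(1)] d(1) c(2) d(2)]
      by (simp add: c(3) d(3))
    moreover have "sym (parcs ?S)"
      by (auto simp: strong_colour_graph_def sym_def)
    then have "(g', g) \<in> (parcs ?S)\<^sup>*"
      using g'(1) by (meson sym_rtrancl symD)
    ultimately show ?thesis
      using f'(1) by (meson rtrancl_trans)
  qed
  ultimately show ?thesis
    by (simp add: connected_pair_graph_iff[OF S] pverts_S)
qed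

end
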